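(* Given two integers $N>k\ge 2$, $$\lceil\log_2(N-k+1)\rceil+k-2<\lceil\log_2(\lceil N/k\rceil-1)\rceil+3k.$$ *)

theory Defs imports Complex_Main
begin

end

theory Submission imports Defs
begin

text \<open>
  Put \<open>M = \<lceil>N / k\<rceil> - 1 \<ge> 1\<close>. Then \<open>N - k + 1 \<le> k M + 1 \<le> (k + 1) M \<le> 2 ^ k M\<close>, so the two
  logarithms differ by at most the integer \<open>k\<close>, and so do their ceilings.
\<close>

theorem proposition15:
  fixes N k :: int
  assumes "k \<ge> 2" and "N > k"
  shows "\<lceil>log 2 (real_of_int (N - k + 1))\<rceil> + k - 2
       < \<lceil>log 2 (real_of_int (\<lceil>real_of_int N / real_of_int k\<rceil> - 1))\<rceil> + 3 * k"
proof -
  define M where "M = \<lceil>real_of_int N / real_of_int k\<rceil> - 1"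
  \<comment> \<open>The power \<open>2 ^ n\<close> needs a natural exponent;
    \<open>k \<ge> 2\<close> makes the conversion lossless.\<close>
  define n where "n = nat k"
  have k: "k = int n" using assms by (simp add: n_def)
  have "real_of_int N / real_of_int k > 1" using assms by simp
  \<comment> \<open>The ceiling of a real strictly above 1 is at least 2.\<close>
  then have M: "M \<ge> 1" unfolding M_def by linarith
  have "real_of_int N / real_of_int k \<le> real_of_int (M + 1)"
    unfolding M_def by linarith
  then have "real_of_int N \<le> real_of_int ((M + 1) * k)"
    using assms by (simp add: divide_le_eq)
  then have "N \<le> (M + 1) * k" by linarith
  then have "N - k + 1 \<le> (k + 1) * M" using M by (simp add: algebra_simps)
  also have "\<dots> \<le> 2 ^ n * M"
  proof (rule mult_right_mono)
    have "n + 1 \<le> 2 ^ n" by (simp add: Suc_leI)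
    then have "int (n + 1) \<le> int (2 ^ n)" by (simp only: of_nat_le_iff)
    then show "k + 1 \<le> 2 ^ n" by (simp add: k)
  qed (use M in simp)
  finally have "real_of_int (N - k + 1) \<le> real_of_int (2 ^ n * M)"
    by (simp only: of_int_le_iff)
  \<comment> \<open>Monotonicity of \<open>log\<close> needs a positive smaller argument, which
    \<open>N > k\<close> supplies.\<close>
  then have "log 2 (real_of_int (N - k + 1)) \<le> log 2 (2 ^ n * real_of_int M)"
    using assms by (intro log_mono) simp_all
  also have "\<dots> = log 2 (real_of_int M) + real_of_int k"
    using M by (simp add: log_mult log_nat_power k)
  finally have "\<lceil>log 2 (real_of_int (N - k + 1))\<rceil> \<le> \<lceil>log 2 (real_of_int M)\<rceil> + k"
    by linarith
  \<comment> \<open>Adding \<open>k - 2\<close> gives at most \<open>2 * k - 2\<close> beyond the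
    right-hand ceiling, short of \<open>3 * k\<close> by \<open>k + 2 > 0\<close>.\<close>
  then show ?thesis using assms unfolding M_def by linarith
qed

end
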